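(* Let $A$ be a Banach algebra and $n\ge 2$ an even number, and suppose $\tilde{Z}_1^\ell(A^{(n)})=A^{(n)}$. If $A^{(n)}$ is weakly amenable, then $A^{(n-2)}$ is weakly amenable.
   Context: $A^{(n)}$ denotes the $n$-th dual of $A$, $A^{(0)}=A$. For a Banach algebra $C$, the first Arens product on $C^{**}$ is defined by $\langle c'c,d\rangle=\langle c',cd\rangle$, $\langle c''c',c\rangle=\langle c'',c'c\rangle$, $\langle c''d'',c'\rangle=\langle c'',d''c'\rangle$ ($c,d\in C$, $c'\in C^*$, $c'',d''\in C^{**}$). For even $n$, $A^{(n)}=(A^{(n-2)})^{**}$ is a Banach algebra with the iterated first Arens product. $\tilde Z_1^\ell(A^{(n)})=\{x\in A^{(n)}: y\mapsto xy\text{ is weak}^*\text{-to-weak continuous on }A^{(n)}\}$, where weak$^*$ means $\sigma(A^{(n)},A^{(n-1)})$ and weak means $\sigma(A^{(n)},A^{(n+1)})$. A Banach algebra $C$ is weakly amenable if $H^1(C,C^* )=\{0\}$, i.e. every bounded derivation $D:C\to C^*$ (with $D(xy)=xD(y)+D(x)y$, $C^*$ with its dual bimodule structure) is inner, i.e. of the form $c\mapsto cf-fc$ for some $f\in C^*$. *)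

theory Defs
  imports "HOL-Analysis.Analysis"
begin

text \<open>
  The dual of a space has a larger cardinality in general, so its functionals cannot literally be
  elements of the type that carries the space. In order to speak of the \<open>n\<close>-th dual for a
  variable \<open>n\<close>, all spaces live on subsets of one type \<open>'u\<close>, and a functional on the
  \<open>k\<close>-th dual is turned into an element of the \<open>(k+1)\<close>-st dual by an
  injective labelling \<open>e k :: ('u \<Rightarrow> 'k) \<Rightarrow> 'u\<close>. For each fixed \<open>n\<close>
  there is a type \<open>'u\<close> with room for such labellings up to level \<open>n\<close>
  (see \<open>labelling_exists\<close> below).

  The scalars form an arbitrary \<open>real_normed_field\<close>; up to isomorphism these are exactly
  the real and the complex numbers.
\<close>

record ('u, 'k) nspace =
  carrier :: "'u set"
  vzero :: 'u
  vadd :: "'u \<Rightarrow> 'u \<Rightarrow> 'u"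
  vscale :: "'k \<Rightarrow> 'u \<Rightarrow> 'u"
  vnorm :: "'u \<Rightarrow> real"

record ('u, 'k) nalg = "('u, 'k) nspace" +
  amult :: "'u \<Rightarrow> 'u \<Rightarrow> 'u"

locale normed_space =
  fixes X :: "('u, 'k::real_normed_field, 'z) nspace_scheme"
  assumes zero_closed: "vzero X \<in> carrier X"
    and add_closed: "\<lbrakk>x \<in> carrier X; y \<in> carrier X\<rbrakk> \<Longrightarrow> vadd X x y \<in> carrier X"
    and scale_closed: "x \<in> carrier X \<Longrightarrow> vscale X a x \<in> carrier X"
    and add_assoc: "\<lbrakk>x \<in> carrier X; y \<in> carrier X; z \<in> carrier X\<rbrakk>
      \<Longrightarrow> vadd X (vadd X x y) z = vadd X x (vadd X y z)"
    and add_commute: "\<lbrakk>x \<in> carrier X; y \<in> carrier X\<rbrakk> \<Longrightarrow> vadd X x y = vadd X y x"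
    and add_zero: "x \<in> carrier X \<Longrightarrow> vadd X x (vzero X) = x"
    and add_neg: "x \<in> carrier X \<Longrightarrow> vadd X x (vscale X (- 1) x) = vzero X"
    and scale_add: "\<lbrakk>x \<in> carrier X; y \<in> carrier X\<rbrakk>
      \<Longrightarrow> vscale X a (vadd X x y) = vadd X (vscale X a x) (vscale X a y)"
    and add_scale: "x \<in> carrier X
      \<Longrightarrow> vscale X (a + b) x = vadd X (vscale X a x) (vscale X b x)"
    and scale_scale: "x \<in> carrier X \<Longrightarrow> vscale X a (vscale X b x) = vscale X (a * b) x"
    and scale_one: "x \<in> carrier X \<Longrightarrow> vscale X 1 x = x"
    and norm_eq_zero: "x \<in> carrier X \<Longrightarrow> vnorm X x = 0 \<longleftrightarrow> x = vzero X"
    and norm_triangle: "\<lbrakk>x \<in> carrier X; y \<in> carrier X\<rbrakk>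
      \<Longrightarrow> vnorm X (vadd X x y) \<le> vnorm X x + vnorm X y"
    and norm_scale: "x \<in> carrier X \<Longrightarrow> vnorm X (vscale X a x) = norm a * vnorm X x"

locale banach_space = normed_space +
  assumes complete:
    "Metric_space.mcomplete (carrier X) (\<lambda>x y. vnorm X (vadd X x (vscale X (- 1) y)))"

locale banach_algebra = banach_space A
  for A :: "('u, 'k::real_normed_field, 'z) nalg_scheme" +
  assumes mult_closed: "\<lbrakk>x \<in> carrier A; y \<in> carrier A\<rbrakk> \<Longrightarrow> amult A x y \<in> carrier A"
    and mult_assoc: "\<lbrakk>x \<in> carrier A; y \<in> carrier A; z \<in> carrier A\<rbrakk>
      \<Longrightarrow> amult A (amult A x y) z = amult A x (amult A y z)"
    and add_mult: "\<lbrakk>x \<in> carrier A; y \<in> carrier A; z \<in> carrier A\<rbrakk>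
      \<Longrightarrow> amult A (vadd A x y) z = vadd A (amult A x z) (amult A y z)"
    and mult_add: "\<lbrakk>x \<in> carrier A; y \<in> carrier A; z \<in> carrier A\<rbrakk>
      \<Longrightarrow> amult A x (vadd A y z) = vadd A (amult A x y) (amult A x z)"
    and scale_mult: "\<lbrakk>x \<in> carrier A; y \<in> carrier A\<rbrakk>
      \<Longrightarrow> amult A (vscale A a x) y = vscale A a (amult A x y)"
    and mult_scale: "\<lbrakk>x \<in> carrier A; y \<in> carrier A\<rbrakk>
      \<Longrightarrow> amult A x (vscale A a y) = vscale A a (amult A x y)"
    and norm_mult: "\<lbrakk>x \<in> carrier A; y \<in> carrier A\<rbrakk>
      \<Longrightarrow> vnorm A (amult A x y) \<le> vnorm A x * vnorm A y"

text \<open>Functionals are set to \<open>0\<close> off the carrier, so that each functional is represented by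
  exactly one function of type \<open>'u \<Rightarrow> 'k\<close>.\<close>

definition on_carrier ::
    "('u, 'k, 'z) nspace_scheme \<Rightarrow> ('u \<Rightarrow> 'k::real_normed_field) \<Rightarrow> 'u \<Rightarrow> 'k" where
  "on_carrier X f = (\<lambda>x. if x \<in> carrier X then f x else 0)"

definition functionals ::
    "('u, 'k::real_normed_field, 'z) nspace_scheme \<Rightarrow> ('u \<Rightarrow> 'k) set" where
  "functionals X = {f.
     (\<forall>x. x \<notin> carrier X \<longrightarrow> f x = 0) \<and>
     (\<forall>x\<in>carrier X. \<forall>y\<in>carrier X. f (vadd X x y) = f x + f y) \<and>
     (\<forall>a. \<forall>x\<in>carrier X. f (vscale X a x) = a * f x) \<and>
     (\<exists>K. \<forall>x\<in>carrier X. norm (f x) \<le> K * vnorm X x)}"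

definition fnorm ::
    "('u, 'k::real_normed_field, 'z) nspace_scheme \<Rightarrow> ('u \<Rightarrow> 'k) \<Rightarrow> real" where
  "fnorm X f = (SUP x\<in>{x \<in> carrier X. vnorm X x \<le> 1}. norm (f x))"

text \<open>\<open>pairing e X p x\<close> is the value \<open>\<langle>p, x\<rangle>\<close> of the functional labelled
  \<open>p\<close>.\<close>

definition pairing ::
    "(('u \<Rightarrow> 'k) \<Rightarrow> 'u) \<Rightarrow> ('u, 'k::real_normed_field, 'z) nspace_scheme \<Rightarrow> 'u \<Rightarrow> 'u \<Rightarrow> 'k" where
  "pairing e X p = inv_into (functionals X) e p"

definition dual ::
    "(('u \<Rightarrow> 'k) \<Rightarrow> 'u) \<Rightarrow> ('u, 'k::real_normed_field, 'z) nspace_scheme \<Rightarrow> ('u, 'k) nspace" where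
  "dual e X =
    \<lparr>carrier = e ` functionals X,
     vzero = e (\<lambda>x. 0),
     vadd = (\<lambda>p q. e (\<lambda>x. pairing e X p x + pairing e X q x)),
     vscale = (\<lambda>a p. e (\<lambda>x. a * pairing e X p x)),
     vnorm = (\<lambda>p. fnorm X (pairing e X p))\<rparr>"

text \<open>First Arens product on the bidual of \<open>C\<close>: with \<open>p, q\<close> in the bidual, \<open>f\<close> in
  the dual and \<open>c, d\<close> in \<open>C\<close>,
  \<open>\<langle>f c, d\<rangle> = \<langle>f, c d\<rangle>\<close>, \<open>\<langle>q f, c\<rangle> = \<langle>q, f c\<rangle>\<close> and
  \<open>\<langle>p q, f\<rangle> = \<langle>p, q f\<rangle>\<close>. Here \<open>e\<close> labels the functionals on \<open>C\<close> and
  \<open>e'\<close> those on the dual of \<open>C\<close>.\<close>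

definition arens_right ::
    "(('u \<Rightarrow> 'k) \<Rightarrow> 'u) \<Rightarrow> ('u, 'k::real_normed_field, 'z) nalg_scheme \<Rightarrow> 'u \<Rightarrow> 'u \<Rightarrow> 'u" where
  "arens_right e C f c = e (on_carrier C (\<lambda>d. pairing e C f (amult C c d)))"

definition arens_left ::
    "(('u \<Rightarrow> 'k) \<Rightarrow> 'u) \<Rightarrow> (('u \<Rightarrow> 'k) \<Rightarrow> 'u) \<Rightarrow> ('u, 'k::real_normed_field, 'z) nalg_scheme
      \<Rightarrow> 'u \<Rightarrow> 'u \<Rightarrow> 'u" where
  "arens_left e e' C q f =
     e (on_carrier C (\<lambda>c. pairing e' (dual e C) q (arens_right e C f c)))"

definition arens ::
    "(('u \<Rightarrow> 'k) \<Rightarrow> 'u) \<Rightarrow> (('u \<Rightarrow> 'k) \<Rightarrow> 'u) \<Rightarrow> ('u, 'k::real_normed_field, 'z) nalg_scheme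
      \<Rightarrow> 'u \<Rightarrow> 'u \<Rightarrow> 'u" where
  "arens e e' C p q =
     e' (on_carrier (dual e C) (\<lambda>f. pairing e' (dual e C) p (arens_left e e' C q f)))"

primrec ndual ::
    "(nat \<Rightarrow> ('u \<Rightarrow> 'k) \<Rightarrow> 'u) \<Rightarrow> ('u, 'k::real_normed_field) nalg \<Rightarrow> nat \<Rightarrow> ('u, 'k) nspace" where
  "ndual e A 0 = nspace.truncate A"
| "ndual e A (Suc n) = dual (e n) (ndual e A n)"

text \<open>\<open>iterated_arens e A m\<close> is the product of the \<open>2m\<close>-th dual.\<close>

primrec iterated_arens ::
    "(nat \<Rightarrow> ('u \<Rightarrow> 'k) \<Rightarrow> 'u) \<Rightarrow> ('u, 'k::real_normed_field) nalg \<Rightarrow> nat \<Rightarrow> 'u \<Rightarrow> 'u \<Rightarrow> 'u" where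
  "iterated_arens e A 0 = amult A"
| "iterated_arens e A (Suc m) =
     arens (e (2 * m)) (e (2 * m + 1))
       (nspace.extend (ndual e A (2 * m)) (nalg.fields (iterated_arens e A m)))"

text \<open>Only meant for even \<open>n\<close>.\<close>

definition ndual_alg ::
    "(nat \<Rightarrow> ('u \<Rightarrow> 'k) \<Rightarrow> 'u) \<Rightarrow> ('u, 'k::real_normed_field) nalg \<Rightarrow> nat \<Rightarrow> ('u, 'k) nalg" where
  "ndual_alg e A n =
     nspace.extend (ndual e A n) (nalg.fields (iterated_arens e A (n div 2)))"

definition labelling ::
    "(nat \<Rightarrow> ('u \<Rightarrow> 'k) \<Rightarrow> 'u) \<Rightarrow> ('u, 'k::real_normed_field) nalg \<Rightarrow> nat \<Rightarrow> bool" where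
  "labelling e A n \<longleftrightarrow> (\<forall>k<n. inj_on (e k) (functionals (ndual e A k)))"

definition sigma_top ::
    "('u, 'k, 'z) nspace_scheme \<Rightarrow> ('u \<Rightarrow> 'k::real_normed_field) set \<Rightarrow> 'u topology" where
  "sigma_top X F = topology_generated_by {{x \<in> carrier X. f x \<in> U} | f U. f \<in> F \<and> open U}"

definition weak_top :: "('u, 'k::real_normed_field, 'z) nspace_scheme \<Rightarrow> 'u topology" where
  "weak_top X = sigma_top X (functionals X)"

text \<open>The weak* topology on the dual of \<open>X\<close>.\<close>

definition weak_star_top ::
    "(('u \<Rightarrow> 'k) \<Rightarrow> 'u) \<Rightarrow> ('u, 'k::real_normed_field, 'z) nspace_scheme \<Rightarrow> 'u topology" where
  "weak_star_top e X = sigma_top (dual e X) ((\<lambda>x p. pairing e X p x) ` carrier X)"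

text \<open>Only meant for even \<open>n \<ge> 2\<close>.\<close>

definition Z1_tilde ::
    "(nat \<Rightarrow> ('u \<Rightarrow> 'k) \<Rightarrow> 'u) \<Rightarrow> ('u, 'k::real_normed_field) nalg \<Rightarrow> nat \<Rightarrow> 'u set" where
  "Z1_tilde e A n = {x \<in> carrier (ndual_alg e A n).
     continuous_map (weak_star_top (e (n - 1)) (ndual e A (n - 1))) (weak_top (ndual_alg e A n))
       (\<lambda>y. amult (ndual_alg e A n) x y)}"

text \<open>The dual bimodule: \<open>\<langle>c f, d\<rangle> = \<langle>f, d c\<rangle>\<close> and
  \<open>\<langle>f c, d\<rangle> = \<langle>f, c d\<rangle>\<close>.\<close>

definition left_act ::
    "('u, 'k::real_normed_field, 'z) nalg_scheme \<Rightarrow> 'u \<Rightarrow> ('u \<Rightarrow> 'k) \<Rightarrow> 'u \<Rightarrow> 'k" where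
  "left_act C c f = on_carrier C (\<lambda>d. f (amult C d c))"

definition right_act ::
    "('u, 'k::real_normed_field, 'z) nalg_scheme \<Rightarrow> ('u \<Rightarrow> 'k) \<Rightarrow> 'u \<Rightarrow> 'u \<Rightarrow> 'k" where
  "right_act C f c = on_carrier C (\<lambda>d. f (amult C c d))"

definition bounded_derivation ::
    "('u, 'k::real_normed_field, 'z) nalg_scheme \<Rightarrow> ('u \<Rightarrow> 'u \<Rightarrow> 'k) \<Rightarrow> bool" where
  "bounded_derivation C D \<longleftrightarrow>
     (\<forall>x\<in>carrier C. D x \<in> functionals C) \<and>
     (\<forall>x\<in>carrier C. \<forall>y\<in>carrier C. D (vadd C x y) = (\<lambda>z. D x z + D y z)) \<and>
     (\<forall>a. \<forall>x\<in>carrier C. D (vscale C a x) = (\<lambda>z. a * D x z)) \<and>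
     (\<exists>K. \<forall>x\<in>carrier C. fnorm C (D x) \<le> K * vnorm C x) \<and>
     (\<forall>x\<in>carrier C. \<forall>y\<in>carrier C.
        D (amult C x y) = (\<lambda>z. left_act C x (D y) z + right_act C (D x) y z))"

definition inner_derivation ::
    "('u, 'k::real_normed_field, 'z) nalg_scheme \<Rightarrow> ('u \<Rightarrow> 'u \<Rightarrow> 'k) \<Rightarrow> bool" where
  "inner_derivation C D \<longleftrightarrow>
     (\<exists>f\<in>functionals C. \<forall>c\<in>carrier C. D c = (\<lambda>z. left_act C c f z - right_act C f c z))"

definition weakly_amenable :: "('u, 'k::real_normed_field, 'z) nalg_scheme \<Rightarrow> bool" where
  "weakly_amenable C \<longleftrightarrow> (\<forall>D. bounded_derivation C D \<longrightarrow> inner_derivation C D)"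

text \<open>Labellings up to level \<open>n\<close> exist as soon as \<open>'u\<close> has subsets
  \<open>S 0, \<dots>, S n\<close> with \<open>A\<close> inside \<open>S 0\<close> and an injection from the scalar functions
  on \<open>S k\<close> into \<open>S (k+1)\<close>; an \<open>n\<close>-fold sum of iterated function types over the
  type of \<open>A\<close> provides them.\<close>

lemma labelling_exists:
  fixes A :: "('u, 'k::real_normed_field) nalg"
  assumes "carrier A \<subseteq> S 0"
    and inj: "\<And>k. k < n \<Longrightarrow> inj_on (g k) {f :: 'u \<Rightarrow> 'k. \<forall>x. x \<notin> S k \<longrightarrow> f x = 0}"
    and img: "\<And>k. k < n \<Longrightarrow> g k ` {f. \<forall>x. x \<notin> S k \<longrightarrow> f x = 0} \<subseteq> S (Suc k)"
  shows "labelling g A n"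
proof -
  have F: "functionals X \<subseteq> {f. \<forall>x. x \<notin> T \<longrightarrow> f x = 0}" if "carrier X \<subseteq> T"
    for X :: "('u, 'k) nspace" and T
    using that by (auto simp: functionals_def)
  have C: "k \<le> n \<Longrightarrow> carrier (ndual g A k) \<subseteq> S k" for k
  proof (induction k)
    case 0
    then show ?case using assms(1) by (simp add: nspace.truncate_def)
  next
    case (Suc k)
    then have "functionals (ndual g A k) \<subseteq> {f. \<forall>x. x \<notin> S k \<longrightarrow> f x = 0}"
      by (intro F) simp
    moreover have "g k ` {f. \<forall>x. x \<notin> S k \<longrightarrow> f x = 0} \<subseteq> S (Suc k)"
      using img[of k] Suc.prems by simp
    ultimately show ?case unfolding dual_def ndual.simps nspace.simps by (meson image_mono order_trans)
  qed
  show ?thesis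
    unfolding labelling_def
    using inj F[OF C] by (meson inj_on_subset less_imp_le)
qed

end

theory Submission
  imports Defs
begin

text \<open>
  Write \<open>C\<close> for the dual of order \<open>n - 2\<close>, so that the dual of order \<open>n\<close> is the
  bidual \<open>C''\<close> with the first Arens product. A bounded derivation \<open>D : C \<rightarrow> C'\<close> is
  extended to its second adjoint \<open>D'' : C'' \<rightarrow> C'''\<close>. The point is that the hypothesis
  makes \<open>D''\<close> a derivation. Expanding the Arens product, the summand
  \<open>\<langle>D'' x, y z\<rangle>\<close> of \<open>\<langle>D'' (x y), z\<rangle>\<close> appears unconditionally, whereas
  the other one comes out as the value of \<open>x\<close> at the functional
  \<open>a \<mapsto> \<langle>D'' y, z a\<rangle>\<close> on \<open>C\<close>, which in general differs from
  \<open>\<langle>D'' y, z x\<rangle>\<close>. Since left multiplication by \<open>z\<close> is weak*-to-weak continuous,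
  \<open>x \<mapsto> \<langle>D'' y, z x\<rangle>\<close> is weak* continuous, hence evaluation at some element of
  \<open>C'\<close>; testing on elements of \<open>C\<close> shows that this element is the functional above, so the two
  values agree (\<open>continuous_multiplication_evaluation\<close>, \<open>second_adjoint_arens\<close>).

  Weak amenability of \<open>C''\<close> now makes \<open>D''\<close> inner, say given by \<open>F\<close>. The canonical map
  \<open>C \<rightarrow> C''\<close> is multiplicative and \<open>D''\<close> restricts to \<open>D\<close>, so the restriction
  of \<open>F\<close> to \<open>C\<close> implements \<open>D\<close> (\<open>inner_if_second_adjoint_inner\<close>).

  What the argument uses of \<open>C\<close> is a normed space with a submultiplicative bilinear product,
  and this structure passes from \<open>C\<close> to \<open>C''\<close> (\<open>nonassoc_normed_algebra_arens\<close>), which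
  gives it for all even duals by induction.
\<close>

section \<open>Functionals and labelled duals\<close>

lemma functionals_linear:
  assumes "f \<in> functionals X" "x \<in> carrier X" 
  shows "y \<in> carrier X \<Longrightarrow> f (vadd X x y) = f x + f y" and "f (vscale X a x) = a * f x"
  using assms by (auto simp: functionals_def)

lemma functionals_off: "f \<in> functionals X \<Longrightarrow> x \<notin> carrier X \<Longrightarrow> f x = 0"
  by (auto simp: functionals_def)

context normed_space
begin

lemma scale_zero: "x \<in> carrier X \<Longrightarrow> vscale X 0 x = vzero X"
  using add_scale[of x 1 "- 1"] add_neg[of x] scale_one[of x] by simp

lemma norm_zero: "vnorm X (vzero X) = 0"
  using norm_eq_zero zero_closed by blast

lemma norm_nonneg:
  assumes "x \<in> carrier X"
  shows "0 \<le> vnorm X x"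
  using norm_triangle[OF assms scale_closed[OF assms, of "- 1"]] add_neg[OF assms]
    norm_scale[OF assms, of "- 1"] norm_zero by simp

lemma functional_zero: "f \<in> functionals X \<Longrightarrow> f (vzero X) = 0"
  using functionals_linear(2)[of f X "vzero X" 0] scale_zero zero_closed by force

lemma functionalI:
  assumes "\<And>x y. x \<in> carrier X \<Longrightarrow> y \<in> carrier X \<Longrightarrow> f (vadd X x y) = f x + f y"
    and "\<And>a x. x \<in> carrier X \<Longrightarrow> f (vscale X a x) = a * f x"
    and "\<And>x. x \<in> carrier X \<Longrightarrow> norm (f x) \<le> K * vnorm X x"
  shows "on_carrier X f \<in> functionals X"
  using assms add_closed scale_closed
  by (auto simp: functionals_def on_carrier_def intro!: exI[of _ K])

lemma bdd_above_unit_ball: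
  assumes f: "f \<in> functionals X"
  shows "bdd_above ((\<lambda>z. norm (f z)) ` {z \<in> carrier X. vnorm X z \<le> 1})"
proof -
  obtain K where K: "\<forall>z\<in>carrier X. norm (f z) \<le> K * vnorm X z"
    using f unfolding functionals_def by blast
  show ?thesis
  proof (rule bdd_aboveI2)
    fix z assume z: "z \<in> {z \<in> carrier X. vnorm X z \<le> 1}"
    have "norm (f z) \<le> K * vnorm X z" using K z by simp
    also have "\<dots> \<le> \<bar>K\<bar> * vnorm X z"
      using z norm_nonneg by (intro mult_right_mono) auto
    also have "\<dots> \<le> \<bar>K\<bar>" using z by (simp add: mult_left_le)
    finally show "norm (f z) \<le> \<bar>K\<bar>" .
  qed
qed

lemma norm_le_fnorm:
  assumes f: "f \<in> functionals X" and x: "x \<in> carrier X"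
  shows "norm (f x) \<le> fnorm X f * vnorm X x"
proof (cases "x = vzero X")
  case True
  then show ?thesis using functional_zero[OF f] norm_zero by simp
next
  case False
  then have pos: "vnorm X x > 0"
    using norm_nonneg[OF x] norm_eq_zero[OF x] by simp
  define y where "y = vscale X (of_real (inverse (vnorm X x))) x"
  have "y \<in> {z \<in> carrier X. vnorm X z \<le> 1}"
    using x pos by (simp add: y_def scale_closed norm_scale norm_inverse)
  then have "norm (f y) \<le> fnorm X f"
    unfolding fnorm_def by (rule cSUP_upper[OF _ bdd_above_unit_ball[OF f]])
  moreover have "norm (f y) = inverse (vnorm X x) * norm (f x)"
    using functionals_linear(2)[OF f x] pos by (simp add: y_def norm_mult norm_inverse)
  ultimately show ?thesis using pos by (simp add: field_simps)
qed

lemma fnorm_le: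
  assumes "0 \<le> K" and "\<And>x. x \<in> carrier X \<Longrightarrow> norm (f x) \<le> K * vnorm X x"
  shows "fnorm X f \<le> K"
  unfolding fnorm_def
proof (rule cSUP_least)
  show "{x \<in> carrier X. vnorm X x \<le> 1} \<noteq> {}" using zero_closed norm_zero by force
  fix x assume "x \<in> {x \<in> carrier X. vnorm X x \<le> 1}"
  then show "norm (f x) \<le> K" 
    using assms(2)[of x] mult_left_le[OF _ assms(1), of "vnorm X x"] by simp
qed

lemma fnorm_nonneg:
  assumes "f \<in> functionals X"
  shows "0 \<le> fnorm X f"
proof -
  have "norm (f (vzero X)) \<le> fnorm X f"
    unfolding fnorm_def using zero_closed norm_zero
    by (intro cSUP_upper bdd_above_unit_ball assms) auto
  then show ?thesis by (meson norm_ge_zero order_trans)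
qed

lemma functional_add:
  assumes f: "f \<in> functionals X" and g: "g \<in> functionals X"
  shows "(\<lambda>x. f x + g x) \<in> functionals X"
proof -
  have "norm (f x + g x) \<le> (fnorm X f + fnorm X g) * vnorm X x" if "x \<in> carrier X" for x
    using norm_le_fnorm[OF f that] norm_le_fnorm[OF g that] norm_triangle_ineq[of "f x" "g x"]
    by (simp add: distrib_right)
  then have "on_carrier X (\<lambda>x. f x + g x) \<in> functionals X"
    by (intro functionalI) (simp_all add: functionals_linear[OF f] functionals_linear[OF g] distrib_left)
  moreover have "on_carrier X (\<lambda>x. f x + g x) = (\<lambda>x. f x + g x)"
    by (auto simp: on_carrier_def functionals_off[OF f] functionals_off[OF g])
  ultimately show ?thesis by simp
qed

lemma functional_scale:
  assumes f: "f \<in> functionals X"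
  shows "(\<lambda>x. a * f x) \<in> functionals X"
proof -
  have "norm (a * f x) \<le> (norm a * fnorm X f) * vnorm X x" if "x \<in> carrier X" for x
    using mult_left_mono[OF norm_le_fnorm[OF f that] norm_ge_zero[of a]]
    by (simp add: norm_mult mult.assoc)
  then have "on_carrier X (\<lambda>x. a * f x) \<in> functionals X"
    by (intro functionalI) (simp_all add: functionals_linear[OF f] distrib_left)
  moreover have "on_carrier X (\<lambda>x. a * f x) = (\<lambda>x. a * f x)"
    by (auto simp: on_carrier_def functionals_off[OF f])
  ultimately show ?thesis by simp
qed

end

locale labelled_dual = normed_space X
  for X :: "('u, 'k::real_normed_field, 'z) nspace_scheme" +
  fixes e :: "('u \<Rightarrow> 'k) \<Rightarrow> 'u"
  assumes inj: "inj_on e (functionals X)"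
begin

lemma pairing_label: "f \<in> functionals X \<Longrightarrow> pairing e X (e f) = f"
  using inj by (simp add: pairing_def inv_into_f_f)

lemma label_closed: "f \<in> functionals X \<Longrightarrow> e f \<in> carrier (dual e X)"
  by (simp add: dual_def)

lemma pairing_functional: "p \<in> carrier (dual e X) \<Longrightarrow> pairing e X p \<in> functionals X"
  by (auto simp: dual_def pairing_label)

lemma label_pairing: "p \<in> carrier (dual e X) \<Longrightarrow> e (pairing e X p) = p"
  by (auto simp: dual_def pairing_label)

lemma dual_eqI:
  assumes "p \<in> carrier (dual e X)" "q \<in> carrier (dual e X)"
    and "\<And>x. x \<in> carrier X \<Longrightarrow> pairing e X p x = pairing e X q x"
  shows "p = q"
proof -
  have "pairing e X p = pairing e X q"
    using assms functionals_off[OF pairing_functional] by (metis ext)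
  then show ?thesis using assms label_pairing by metis
qed

lemma pairing_linear:
  assumes "p \<in> carrier (dual e X)" "x \<in> carrier X"
  shows "y \<in> carrier X \<Longrightarrow> pairing e X p (vadd X x y) = pairing e X p x + pairing e X p y"
    and "pairing e X p (vscale X a x) = a * pairing e X p x"
  using functionals_linear[OF pairing_functional] assms by blast+

lemma dual_add:
  assumes "p \<in> carrier (dual e X)" "q \<in> carrier (dual e X)"
  shows "vadd (dual e X) p q \<in> carrier (dual e X)"
    and "pairing e X (vadd (dual e X) p q) x = pairing e X p x + pairing e X q x"
proof -
  have *: "(\<lambda>x. pairing e X p x + pairing e X q x) \<in> functionals X"
    using assms functional_add pairing_functional by blast
  show "vadd (dual e X) p q \<in> carrier (dual e X)"
    using * by (simp add: dual_def)
  show "pairing e X (vadd (dual e X) p q) x = pairing e X p x + pairing e X q x"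
    using pairing_label[OF *] by (simp add: dual_def)
qed

lemma dual_scale:
  assumes "p \<in> carrier (dual e X)"
  shows "vscale (dual e X) a p \<in> carrier (dual e X)"
    and "pairing e X (vscale (dual e X) a p) x = a * pairing e X p x"
proof -
  have *: "(\<lambda>x. a * pairing e X p x) \<in> functionals X"
    using assms functional_scale pairing_functional by blast
  show "vscale (dual e X) a p \<in> carrier (dual e X)"
    using * by (simp add: dual_def)
  show "pairing e X (vscale (dual e X) a p) x = a * pairing e X p x"
    using pairing_label[OF *] by (simp add: dual_def)
qed

lemma dual_zero:
  shows "vzero (dual e X) \<in> carrier (dual e X)"
    and "pairing e X (vzero (dual e X)) x = 0"
proof -
  have *: "(\<lambda>x. 0) \<in> functionals X"
    by (auto simp: functionals_def intro!: exI[of _ 0])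
  show "vzero (dual e X) \<in> carrier (dual e X)"
    using * by (simp add: dual_def)
  show "pairing e X (vzero (dual e X)) x = 0"
    using pairing_label[OF *] by (simp add: dual_def)
qed

lemma dual_norm: "vnorm (dual e X) p = fnorm X (pairing e X p)"
  by (simp add: dual_def)

lemma norm_pairing_le:
  "p \<in> carrier (dual e X) \<Longrightarrow> x \<in> carrier X \<Longrightarrow>
    norm (pairing e X p x) \<le> vnorm (dual e X) p * vnorm X x"
  by (simp add: dual_norm norm_le_fnorm pairing_functional)

lemma dual_norm_le:
  "0 \<le> K \<Longrightarrow> (\<And>x. x \<in> carrier X \<Longrightarrow> norm (pairing e X p x) \<le> K * vnorm X x) \<Longrightarrow>
    vnorm (dual e X) p \<le> K"
  by (simp add: dual_norm fnorm_le)

lemma dual_norm_nonneg: "p \<in> carrier (dual e X) \<Longrightarrow> 0 \<le> vnorm (dual e X) p"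
  by (simp add: dual_norm fnorm_nonneg pairing_functional)

lemma dual_norm_scale_le:
  assumes "p \<in> carrier (dual e X)"
  shows "vnorm (dual e X) (vscale (dual e X) a p) \<le> norm a * vnorm (dual e X) p"
  using norm_pairing_le[OF assms] dual_norm_nonneg[OF assms]
  by (intro dual_norm_le) (auto simp: dual_scale[OF assms] norm_mult mult.assoc intro!: mult_left_mono)

lemma normed_space_dual: "normed_space (dual e X)"
proof
  note closed = dual_add(1) dual_scale(1) dual_zero(1)
  note val = dual_add(2) dual_scale(2) dual_zero(2)
  fix p q r a b
  assume p: "p \<in> carrier (dual e X)"
  show "vadd (dual e X) p (vzero (dual e X)) = p"
    by (rule dual_eqI) (simp_all add: p closed val)
  show "vadd (dual e X) p (vscale (dual e X) (- 1) p) = vzero (dual e X)"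
    by (rule dual_eqI) (simp_all add: p closed val)
  show "vscale (dual e X) (a + b) p = vadd (dual e X) (vscale (dual e X) a p) (vscale (dual e X) b p)"
    by (rule dual_eqI) (simp_all add: p closed val algebra_simps)
  show "vscale (dual e X) a (vscale (dual e X) b p) = vscale (dual e X) (a * b) p"
    by (rule dual_eqI) (simp_all add: p closed val algebra_simps)
  show "vscale (dual e X) 1 p = p"
    by (rule dual_eqI) (simp_all add: p closed val algebra_simps)
  show "vnorm (dual e X) p = 0 \<longleftrightarrow> p = vzero (dual e X)"
  proof
    assume "vnorm (dual e X) p = 0"
    then show "p = vzero (dual e X)"
      using norm_pairing_le[OF p] by (intro dual_eqI) (auto simp: p closed val)
  next
    assume "p = vzero (dual e X)"
    then have "vnorm (dual e X) p \<le> 0" by (intro dual_norm_le) (auto simp: val)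
    then show "vnorm (dual e X) p = 0" using dual_norm_nonneg[OF p] by simp
  qed
  show "vnorm (dual e X) (vscale (dual e X) a p) = norm a * vnorm (dual e X) p"
  proof (cases "a = 0")
    case True
    then show ?thesis
      using dual_norm_scale_le[OF p, of a] dual_norm_nonneg[OF closed(2)[OF p, of a]] by simp
  next
    case False
    have "vscale (dual e X) (inverse a) (vscale (dual e X) a p) = p"
      by (rule dual_eqI) (use False in \<open>simp_all add: p closed val\<close>)
    then have "vnorm (dual e X) p \<le> inverse (norm a) * vnorm (dual e X) (vscale (dual e X) a p)"
      using dual_norm_scale_le[OF closed(2)[OF p, of a], of "inverse a"]
      by (simp add: norm_inverse)
    then show ?thesis using dual_norm_scale_le[OF p, of a] False by (simp add: field_simps)
  qed
  assume q: "q \<in> carrier (dual e X)"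
  show "vadd (dual e X) p q = vadd (dual e X) q p"
    by (rule dual_eqI) (simp_all add: p q closed val)
  show "vscale (dual e X) a (vadd (dual e X) p q)
      = vadd (dual e X) (vscale (dual e X) a p) (vscale (dual e X) a q)"
    by (rule dual_eqI) (simp_all add: p q closed val algebra_simps)
  show "vnorm (dual e X) (vadd (dual e X) p q) \<le> vnorm (dual e X) p + vnorm (dual e X) q"
  proof (rule dual_norm_le)
    show "0 \<le> vnorm (dual e X) p + vnorm (dual e X) q"
      using dual_norm_nonneg p q by simp
    fix x assume "x \<in> carrier X"
    then show "norm (pairing e X (vadd (dual e X) p q) x)
        \<le> (vnorm (dual e X) p + vnorm (dual e X) q) * vnorm X x"
      using norm_pairing_le[OF p, of x] norm_pairing_le[OF q, of x]
      by (auto simp: val p q distrib_right intro!: norm_triangle_le)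
  qed
  assume r: "r \<in> carrier (dual e X)"
  show "vadd (dual e X) (vadd (dual e X) p q) r = vadd (dual e X) p (vadd (dual e X) q r)"
    by (rule dual_eqI) (simp_all add: p q r closed val)
qed (simp_all add: dual_add dual_scale dual_zero)

lemma label_on_carrier:
  assumes "\<And>x y. x \<in> carrier X \<Longrightarrow> y \<in> carrier X \<Longrightarrow> f (vadd X x y) = f x + f y"
    and "\<And>a x. x \<in> carrier X \<Longrightarrow> f (vscale X a x) = a * f x"
    and "\<And>x. x \<in> carrier X \<Longrightarrow> norm (f x) \<le> K * vnorm X x"
  shows "e (on_carrier X f) \<in> carrier (dual e X)"
    and "x \<in> carrier X \<Longrightarrow> pairing e X (e (on_carrier X f)) x = f x"
    and "0 \<le> K \<Longrightarrow> vnorm (dual e X) (e (on_carrier X f)) \<le> K"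
proof -
  note F = functionalI[of f K, OF assms]
  show "e (on_carrier X f) \<in> carrier (dual e X)" using F by (simp add: label_closed)
  show *: "pairing e X (e (on_carrier X f)) x = f x" if "x \<in> carrier X" for x
    using that F by (simp add: pairing_label on_carrier_def)
  show "vnorm (dual e X) (e (on_carrier X f)) \<le> K" if "0 \<le> K"
    by (rule dual_norm_le) (use that assms(3) * in auto)
qed

section \<open>Weak* continuous functionals\<close>

text \<open>Linear algebra behind the duality of \<open>X\<close> and its weak* dual: a linear form
  \<open>\<phi>\<close> that vanishes wherever finitely many evaluations vanish is a linear combination of
  them, and a combination of evaluations is again an evaluation. In the induction step the new point
  is either redundant or separated from the others by some \<open>p0\<close>, and then subtracting
  \<open>\<phi> p0\<close> times the evaluation at the new point reduces to the smaller set.\<close>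

lemma evaluation_if_kernel:
  assumes "finite S" "S \<subseteq> carrier X"
    and "\<And>p q. p \<in> carrier (dual e X) \<Longrightarrow> q \<in> carrier (dual e X) \<Longrightarrow>
      \<phi> (vadd (dual e X) p q) = \<phi> p + \<phi> q"
    and "\<And>a p. p \<in> carrier (dual e X) \<Longrightarrow> \<phi> (vscale (dual e X) a p) = a * \<phi> p"
    and "\<And>p. p \<in> carrier (dual e X) \<Longrightarrow> \<forall>x\<in>S. pairing e X p x = 0 \<Longrightarrow> \<phi> p = 0"
  shows "\<exists>x\<in>carrier X. \<forall>p\<in>carrier (dual e X). \<phi> p = pairing e X p x"
  using assms
proof (induction S arbitrary: \<phi> rule: finite_induct)
  case empty
  then show ?case
    using zero_closed functional_zero pairing_functional by (metis empty_iff)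
next
  case (insert x0 S)
  note add = insert.prems(2) and scale = insert.prems(3) and ker = insert.prems(4)
  show ?case
  proof (cases "\<forall>p\<in>carrier (dual e X). (\<forall>x\<in>S. pairing e X p x = 0) \<longrightarrow> pairing e X p x0 = 0")
    case True
    then show ?thesis using insert.IH[of \<phi>] insert.prems by simp
  next
    case False
    then obtain p1 where p1: "p1 \<in> carrier (dual e X)" "\<And>x. x \<in> S \<Longrightarrow> pairing e X p1 x = 0"
      "pairing e X p1 x0 \<noteq> 0" by blast
    define p0 where "p0 = vscale (dual e X) (inverse (pairing e X p1 x0)) p1"
    have p0: "p0 \<in> carrier (dual e X)" "\<And>x. x \<in> S \<Longrightarrow> pairing e X p0 x = 0"
      "pairing e X p0 x0 = 1"
      using p1 by (auto simp: p0_def dual_scale)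
    have x0: "x0 \<in> carrier X" and S: "S \<subseteq> carrier X" using insert.prems(1) by auto
    have "\<exists>x\<in>carrier X. \<forall>p\<in>carrier (dual e X). \<phi> p - \<phi> p0 * pairing e X p x0 = pairing e X p x"
    proof (rule insert.IH[OF S])
      fix p assume p: "p \<in> carrier (dual e X)" and z: "\<forall>x\<in>S. pairing e X p x = 0"
      \<comment> \<open>The projection of \<open>p\<close> along \<open>p0\<close> also vanishes at \<open>x0\<close>.\<close>
      define q where "q = vadd (dual e X) p (vscale (dual e X) (- pairing e X p x0) p0)"
      have "q \<in> carrier (dual e X)" "\<forall>x\<in>insert x0 S. pairing e X q x = 0"
        using p p0 z by (auto simp: q_def dual_add dual_scale)
      then have "\<phi> q = 0" using ker by blast
      then show "\<phi> p - \<phi> p0 * pairing e X p x0 = 0"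
        using p p0(1) by (simp add: q_def add scale dual_scale)
    qed (simp_all add: add scale dual_add dual_scale algebra_simps)
    then obtain x where x: "x \<in> carrier X"
      "\<And>p. p \<in> carrier (dual e X) \<Longrightarrow> \<phi> p - \<phi> p0 * pairing e X p x0 = pairing e X p x" by blast
    have "\<phi> p = pairing e X p (vadd X x (vscale X (\<phi> p0) x0))" if "p \<in> carrier (dual e X)" for p
      using that x x0 by (simp add: pairing_linear scale_closed flip: x(2))
    then show ?thesis using x x0 add_closed scale_closed by blast
  qed
qed

end

lemma sigma_top_nbhd:
  assumes "openin (sigma_top X F) U" "x0 \<in> U"
  shows "\<exists>G \<epsilon>. finite G \<and> G \<subseteq> F \<and> \<epsilon> > 0 \<and>
    {x \<in> carrier X. \<forall>f\<in>G. dist (f x) (f x0) < \<epsilon>} \<subseteq> U"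
proof -
  have "generate_topology_on {{x \<in> carrier X. f x \<in> V} | f V. f \<in> F \<and> open V} U"
    using assms(1) by (simp add: sigma_top_def openin_topology_generated_by)
  then show ?thesis using assms(2)
  proof induction
    case Empty
    then show ?case by simp
  next
    case (Int a b)
    obtain G1 \<epsilon>1 where G1:
      "finite G1" "G1 \<subseteq> F" "\<epsilon>1 > 0" "{x \<in> carrier X. \<forall>f\<in>G1. dist (f x) (f x0) < \<epsilon>1} \<subseteq> a"
      using Int.IH(1) Int.prems by blast
    obtain G2 \<epsilon>2 where G2:
      "finite G2" "G2 \<subseteq> F" "\<epsilon>2 > 0" "{x \<in> carrier X. \<forall>f\<in>G2. dist (f x) (f x0) < \<epsilon>2} \<subseteq> b"
      using Int.IH(2) Int.prems by blast
    have "{x \<in> carrier X. \<forall>f\<in>G1 \<union> G2. dist (f x) (f x0) < min \<epsilon>1 \<epsilon>2} \<subseteq> a \<inter> b"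
      using G1(4) G2(4) by (simp add: subset_iff)
    moreover have "finite (G1 \<union> G2)" "G1 \<union> G2 \<subseteq> F" "min \<epsilon>1 \<epsilon>2 > 0"
      using G1 G2 by auto
    ultimately show ?case by blast
  next
    case (UN K)
    then obtain k where "k \<in> K" "x0 \<in> k" by blast
    then show ?case using UN.IH[of k] by (meson Union_upper order_trans)
  next
    case (Basis s)
    then obtain f V where s: "s = {x \<in> carrier X. f x \<in> V}" "f \<in> F" "open V" by blast
    then obtain \<epsilon> where "\<epsilon> > 0" "\<forall>y. dist y (f x0) < \<epsilon> \<longrightarrow> y \<in> V"
      using Basis.prems unfolding open_dist by blast
    then have "{x \<in> carrier X. \<forall>g\<in>{f}. dist (g x) (g x0) < \<epsilon>} \<subseteq> s" using s by blast
    moreover have "finite {f}" "{f} \<subseteq> F" using s by auto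
    ultimately show ?case using \<open>\<epsilon> > 0\<close> by blast
  qed
qed

text \<open>A weak* neighbourhood of \<open>0\<close> contains the common kernel of finitely many
  evaluations. A linear form that is bounded by \<open>1\<close> on such a kernel vanishes on it, because the
  kernel is closed under scaling.\<close>

lemma (in labelled_dual) weak_star_continuous_evaluation:
  assumes add: "\<And>p q. p \<in> carrier (dual e X) \<Longrightarrow> q \<in> carrier (dual e X) \<Longrightarrow>
      \<phi> (vadd (dual e X) p q) = \<phi> p + \<phi> q"
    and scale: "\<And>a p. p \<in> carrier (dual e X) \<Longrightarrow> \<phi> (vscale (dual e X) a p) = a * \<phi> p"
    and "openin (weak_star_top e X) {p \<in> topspace (weak_star_top e X). \<phi> p \<in> ball 0 1}"
  shows "\<exists>x\<in>carrier X. \<forall>p\<in>carrier (dual e X). \<phi> p = pairing e X p x"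
proof -
  let ?U = "{p \<in> topspace (weak_star_top e X). \<phi> p \<in> ball 0 1}"
  \<comment> \<open>Evaluation at \<open>0\<close> shows that the carrier is open and so lies in the topspace.\<close>
  have "openin (weak_star_top e X) {p \<in> carrier (dual e X). pairing e X p (vzero X) \<in> UNIV}"
    unfolding weak_star_top_def sigma_top_def
    by (rule topology_generated_by_Basis) (use zero_closed open_UNIV in blast)
  then have "vzero (dual e X) \<in> topspace (weak_star_top e X)"
    using dual_zero(1) openin_subset by blast
  moreover have "\<phi> (vzero (dual e X)) = 0"
  proof -
    have "vscale (dual e X) 0 (vzero (dual e X)) = vzero (dual e X)"
      by (rule dual_eqI) (simp_all add: dual_zero dual_scale)
    then show ?thesis using scale[OF dual_zero(1), of 0] by simp
  qed
  ultimately have "vzero (dual e X) \<in> ?U" by simp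
  with assms(3) have "\<exists>G \<epsilon>. finite G \<and> G \<subseteq> (\<lambda>x p. pairing e X p x) ` carrier X \<and> \<epsilon> > 0 \<and>
    {p \<in> carrier (dual e X). \<forall>f\<in>G. dist (f p) (f (vzero (dual e X))) < \<epsilon>} \<subseteq> ?U"
    unfolding weak_star_top_def by (intro sigma_top_nbhd)
  then obtain G \<epsilon> where G: "finite G" "G \<subseteq> (\<lambda>x p. pairing e X p x) ` carrier X" "\<epsilon> > 0"
    "{p \<in> carrier (dual e X). \<forall>f\<in>G. dist (f p) (f (vzero (dual e X))) < \<epsilon>} \<subseteq> ?U"
    by (elim exE conjE) (rule that)
  obtain S where S: "S \<subseteq> carrier X" "finite S" "G = (\<lambda>x p. pairing e X p x) ` S"
    using finite_subset_image[OF G(1,2)] by blast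
  have small: "norm (\<phi> p) < 1"
    if "p \<in> carrier (dual e X)" "\<forall>x\<in>S. pairing e X p x = 0" for p
  proof -
    have "p \<in> {p \<in> carrier (dual e X). \<forall>f\<in>G. dist (f p) (f (vzero (dual e X))) < \<epsilon>}"
      using that G(3) by (simp add: S(3) dual_zero)
    then have "p \<in> ?U" using G(4) by (rule rev_subsetD)
    then show ?thesis by simp
  qed
  show ?thesis
  proof (rule evaluation_if_kernel[OF S(2,1) add scale])
    fix p assume p: "p \<in> carrier (dual e X)" and z: "\<forall>x\<in>S. pairing e X p x = 0"
    show "\<phi> p = 0"
    proof (rule ccontr)
      assume "\<phi> p \<noteq> 0"
      then have "\<phi> (vscale (dual e X) (inverse (\<phi> p)) p) = 1" by (simp add: scale p)
      then show False
        using small[of "vscale (dual e X) (inverse (\<phi> p)) p"] p z by (simp add: dual_scale)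
    qed
  qed
qed

section \<open>The bidual with the first Arens product\<close>

text \<open>What the passage to the second adjoint uses of a Banach algebra. The bidual inherits it, so
  inductions over the iterated biduals stay within this locale.\<close>

locale nonassoc_normed_algebra = normed_space C
  for C :: "('u, 'k::real_normed_field, 'z) nalg_scheme" +
  assumes mult_closed: "\<lbrakk>x \<in> carrier C; y \<in> carrier C\<rbrakk> \<Longrightarrow> amult C x y \<in> carrier C"
    and add_mult: "\<lbrakk>x \<in> carrier C; y \<in> carrier C; z \<in> carrier C\<rbrakk>
      \<Longrightarrow> amult C (vadd C x y) z = vadd C (amult C x z) (amult C y z)"
    and mult_add: "\<lbrakk>x \<in> carrier C; y \<in> carrier C; z \<in> carrier C\<rbrakk>
      \<Longrightarrow> amult C x (vadd C y z) = vadd C (amult C x y) (amult C x z)"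
    and scale_mult: "\<lbrakk>x \<in> carrier C; y \<in> carrier C\<rbrakk>
      \<Longrightarrow> amult C (vscale C a x) y = vscale C a (amult C x y)"
    and mult_scale: "\<lbrakk>x \<in> carrier C; y \<in> carrier C\<rbrakk>
      \<Longrightarrow> amult C x (vscale C a y) = vscale C a (amult C x y)"
    and norm_mult_le: "\<lbrakk>x \<in> carrier C; y \<in> carrier C\<rbrakk>
      \<Longrightarrow> vnorm C (amult C x y) \<le> vnorm C x * vnorm C y"

lemma functionals_extend [simp]: "functionals (nspace.extend X m) = functionals X"
  by (simp add: functionals_def nspace.extend_def)

lemma fnorm_extend [simp]: "fnorm (nspace.extend X m) = fnorm X"
  by (simp add: fnorm_def nspace.extend_def fun_eq_iff)

lemma dual_extend [simp]: "dual e (nspace.extend X m) = dual e X"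
  by (simp add: dual_def pairing_def)

definition arens_algebra ::
    "(('u \<Rightarrow> 'k) \<Rightarrow> 'u) \<Rightarrow> (('u \<Rightarrow> 'k) \<Rightarrow> 'u) \<Rightarrow> ('u, 'k::real_normed_field, 'z) nalg_scheme
      \<Rightarrow> ('u, 'k) nalg" where
  "arens_algebra e e' C = nspace.extend (dual e' (dual e C)) (nalg.fields (arens e e' C))"

lemma arens_algebra_simps [simp]:
  "carrier (arens_algebra e e' C) = carrier (dual e' (dual e C))"
  "vzero (arens_algebra e e' C) = vzero (dual e' (dual e C))"
  "vadd (arens_algebra e e' C) = vadd (dual e' (dual e C))"
  "vscale (arens_algebra e e' C) = vscale (dual e' (dual e C))"
  "vnorm (arens_algebra e e' C) = vnorm (dual e' (dual e C))"
  "amult (arens_algebra e e' C) = arens e e' C"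
  "functionals (arens_algebra e e' C) = functionals (dual e' (dual e C))"
  "fnorm (arens_algebra e e' C) = fnorm (dual e' (dual e C))"
  by (simp_all add: arens_algebra_def) (simp_all add: nspace.extend_def nalg.fields_def)

locale arens_bidual = nonassoc_normed_algebra C
  for C :: "('u, 'k::real_normed_field, 'z) nalg_scheme" +
  fixes e e' :: "('u \<Rightarrow> 'k) \<Rightarrow> 'u"
  assumes inj_e: "inj_on e (functionals C)"
    and inj_e': "inj_on e' (functionals (dual e C))"
begin

abbreviation C' where "C' \<equiv> dual e C"
abbreviation C'' where "C'' \<equiv> dual e' C'"
abbreviation ev where "ev \<equiv> pairing e C"
abbreviation ev' where "ev' \<equiv> pairing e' C'"

sublocale D1: labelled_dual C e
  by unfold_locales (rule inj_e)

sublocale D2: labelled_dual C' e'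
  by (intro labelled_dual.intro labelled_dual_axioms.intro D1.normed_space_dual inj_e')

lemma arens_right_closed:
    "f \<in> carrier C' \<Longrightarrow> c \<in> carrier C \<Longrightarrow> arens_right e C f c \<in> carrier C'"
  and arens_right_apply: "f \<in> carrier C' \<Longrightarrow> c \<in> carrier C \<Longrightarrow> d \<in> carrier C \<Longrightarrow>
    ev (arens_right e C f c) d = ev f (amult C c d)"
  and arens_right_norm: "f \<in> carrier C' \<Longrightarrow> c \<in> carrier C \<Longrightarrow>
    vnorm C' (arens_right e C f c) \<le> vnorm C' f * vnorm C c"
proof -
  assume fc: "f \<in> carrier C'" "c \<in> carrier C"
  have bound: "norm (ev f (amult C c d)) \<le> (vnorm C' f * vnorm C c) * vnorm C d"
    if d: "d \<in> carrier C" for d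
  proof -
    have "norm (ev f (amult C c d)) \<le> vnorm C' f * vnorm C (amult C c d)"
      using fc d by (intro D1.norm_pairing_le mult_closed)
    also have "\<dots> \<le> vnorm C' f * (vnorm C c * vnorm C d)"
      using fc d by (intro mult_left_mono norm_mult_le D1.dual_norm_nonneg)
    finally show ?thesis by (simp add: mult.assoc)
  qed
  note L = D1.label_on_carrier[of "\<lambda>d. ev f (amult C c d)", OF _ _ bound]
  show "arens_right e C f c \<in> carrier C'"
    unfolding arens_right_def
    by (rule L(1)) (simp_all add: fc mult_add mult_scale mult_closed D1.pairing_linear)
  show "ev (arens_right e C f c) d = ev f (amult C c d)" if "d \<in> carrier C"
    unfolding arens_right_def
    by (rule L(2)) (simp_all add: that fc mult_add mult_scale mult_closed D1.pairing_linear)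
  show "vnorm C' (arens_right e C f c) \<le> vnorm C' f * vnorm C c"
    unfolding arens_right_def
    by (rule L(3)) (simp_all add: fc mult_add mult_scale mult_closed D1.pairing_linear
        D1.dual_norm_nonneg norm_nonneg)
qed

lemma arens_right_linear:
  assumes "f \<in> carrier C'" "c \<in> carrier C"
  shows "g \<in> carrier C' \<Longrightarrow>
      arens_right e C (vadd C' f g) c = vadd C' (arens_right e C f c) (arens_right e C g c)"
    and "arens_right e C (vscale C' a f) c = vscale C' a (arens_right e C f c)"
    and "d \<in> carrier C \<Longrightarrow>
      arens_right e C f (vadd C c d) = vadd C' (arens_right e C f c) (arens_right e C f d)"
    and "arens_right e C f (vscale C a c) = vscale C' a (arens_right e C f c)"
  by (rule D1.dual_eqI;
      use assms in \<open>simp add: arens_right_closed arens_right_apply D1.dual_add D1.dual_scale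
        add_closed scale_closed mult_closed add_mult scale_mult D1.pairing_linear\<close>)+

lemma arens_left_closed:
    "x \<in> carrier C'' \<Longrightarrow> f \<in> carrier C' \<Longrightarrow> arens_left e e' C x f \<in> carrier C'"
  and arens_left_apply: "x \<in> carrier C'' \<Longrightarrow> f \<in> carrier C' \<Longrightarrow> c \<in> carrier C \<Longrightarrow>
    ev (arens_left e e' C x f) c = ev' x (arens_right e C f c)"
  and arens_left_norm: "x \<in> carrier C'' \<Longrightarrow> f \<in> carrier C' \<Longrightarrow>
    vnorm C' (arens_left e e' C x f) \<le> vnorm C'' x * vnorm C' f"
proof -
  assume xf: "x \<in> carrier C''" "f \<in> carrier C'"
  have bound: "norm (ev' x (arens_right e C f c)) \<le> (vnorm C'' x * vnorm C' f) * vnorm C c"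
    if c: "c \<in> carrier C" for c
  proof -
    have "norm (ev' x (arens_right e C f c)) \<le> vnorm C'' x * vnorm C' (arens_right e C f c)"
      using xf c by (intro D2.norm_pairing_le arens_right_closed)
    also have "\<dots> \<le> vnorm C'' x * (vnorm C' f * vnorm C c)"
      using xf c by (intro mult_left_mono arens_right_norm D2.dual_norm_nonneg)
    finally show ?thesis by (simp add: mult.assoc)
  qed
  note L = D1.label_on_carrier[of "\<lambda>c. ev' x (arens_right e C f c)", OF _ _ bound]
  note lin = arens_right_linear arens_right_closed D2.pairing_linear
  show "arens_left e e' C x f \<in> carrier C'"
    unfolding arens_left_def by (rule L(1)) (simp_all add: xf lin)
  show "ev (arens_left e e' C x f) c = ev' x (arens_right e C f c)" if "c \<in> carrier C"
    unfolding arens_left_def by (rule L(2)) (simp_all add: that xf lin)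
  show "vnorm C' (arens_left e e' C x f) \<le> vnorm C'' x * vnorm C' f"
    unfolding arens_left_def
    by (rule L(3)) (simp_all add: xf lin D1.dual_norm_nonneg D2.dual_norm_nonneg)
qed

lemma arens_left_linear:
  assumes "x \<in> carrier C''" "f \<in> carrier C'"
  shows "y \<in> carrier C'' \<Longrightarrow>
      arens_left e e' C (vadd C'' x y) f = vadd C' (arens_left e e' C x f) (arens_left e e' C y f)"
    and "arens_left e e' C (vscale C'' a x) f = vscale C' a (arens_left e e' C x f)"
    and "g \<in> carrier C' \<Longrightarrow>
      arens_left e e' C x (vadd C' f g) = vadd C' (arens_left e e' C x f) (arens_left e e' C x g)"
    and "arens_left e e' C x (vscale C' a f) = vscale C' a (arens_left e e' C x f)"
  by (rule D1.dual_eqI;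
      use assms in \<open>simp add: arens_left_closed arens_left_apply D1.dual_add D1.dual_scale
        D2.dual_add D2.dual_scale arens_right_linear arens_right_closed D2.pairing_linear\<close>)+

lemma arens_closed:
    "x \<in> carrier C'' \<Longrightarrow> y \<in> carrier C'' \<Longrightarrow> arens e e' C x y \<in> carrier C''"
  and arens_apply: "x \<in> carrier C'' \<Longrightarrow> y \<in> carrier C'' \<Longrightarrow> f \<in> carrier C' \<Longrightarrow>
    ev' (arens e e' C x y) f = ev' x (arens_left e e' C y f)"
  and arens_norm: "x \<in> carrier C'' \<Longrightarrow> y \<in> carrier C'' \<Longrightarrow>
    vnorm C'' (arens e e' C x y) \<le> vnorm C'' x * vnorm C'' y"
proof -
  assume xy: "x \<in> carrier C''" "y \<in> carrier C''"
  have bound: "norm (ev' x (arens_left e e' C y f)) \<le> (vnorm C'' x * vnorm C'' y) * vnorm C' f"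
    if f: "f \<in> carrier C'" for f
  proof -
    have "norm (ev' x (arens_left e e' C y f)) \<le> vnorm C'' x * vnorm C' (arens_left e e' C y f)"
      using xy f by (intro D2.norm_pairing_le arens_left_closed)
    also have "\<dots> \<le> vnorm C'' x * (vnorm C'' y * vnorm C' f)"
      using xy f by (intro mult_left_mono arens_left_norm D2.dual_norm_nonneg)
    finally show ?thesis by (simp add: mult.assoc)
  qed
  note L = D2.label_on_carrier[of "\<lambda>f. ev' x (arens_left e e' C y f)", OF _ _ bound]
  note lin = arens_left_linear arens_left_closed D2.pairing_linear
  show "arens e e' C x y \<in> carrier C''"
    unfolding arens_def by (rule L(1)) (simp_all add: xy lin)
  show "ev' (arens e e' C x y) f = ev' x (arens_left e e' C y f)" if "f \<in> carrier C'"
    unfolding arens_def by (rule L(2)) (simp_all add: that xy lin)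
  show "vnorm C'' (arens e e' C x y) \<le> vnorm C'' x * vnorm C'' y"
    unfolding arens_def
    by (rule L(3)) (simp_all add: xy lin D2.dual_norm_nonneg)
qed

lemma arens_linear:
  assumes "x \<in> carrier C''" "y \<in> carrier C''"
  shows "z \<in> carrier C'' \<Longrightarrow>
      arens e e' C (vadd C'' x z) y = vadd C'' (arens e e' C x y) (arens e e' C z y)"
    and "arens e e' C (vscale C'' a x) y = vscale C'' a (arens e e' C x y)"
    and "z \<in> carrier C'' \<Longrightarrow>
      arens e e' C x (vadd C'' y z) = vadd C'' (arens e e' C x y) (arens e e' C x z)"
    and "arens e e' C x (vscale C'' a y) = vscale C'' a (arens e e' C x y)"
  by (rule D2.dual_eqI;
      use assms in \<open>simp add: arens_closed arens_apply D2.dual_add D2.dual_scale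
        arens_left_linear arens_left_closed D2.pairing_linear\<close>)+

lemma nonassoc_normed_algebra_arens: "nonassoc_normed_algebra (arens_algebra e e' C)"
proof -
  interpret E: normed_space C'' by (rule D2.normed_space_dual)
  show ?thesis
    by (unfold_locales; simp only: arens_algebra_simps; (intro E.add_assoc E.add_commute; assumption)?)
      (simp_all add: arens_closed arens_linear arens_norm E.zero_closed E.add_closed E.scale_closed
        E.add_zero E.add_neg E.scale_add E.add_scale E.scale_scale E.scale_one
        E.norm_eq_zero E.norm_triangle E.norm_scale)
qed

text \<open>The canonical map into the bidual.\<close>

definition embed :: "'u \<Rightarrow> 'u" where
  "embed c = e' (on_carrier C' (\<lambda>f. ev f c))"

lemma embed_closed: "c \<in> carrier C \<Longrightarrow> embed c \<in> carrier C''"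
  and embed_apply: "c \<in> carrier C \<Longrightarrow> f \<in> carrier C' \<Longrightarrow> ev' (embed c) f = ev f c"
  and embed_norm: "c \<in> carrier C \<Longrightarrow> vnorm C'' (embed c) \<le> vnorm C c"
proof -
  assume c: "c \<in> carrier C"
  have bound: "norm (ev f c) \<le> vnorm C c * vnorm C' f" if "f \<in> carrier C'" for f
    using D1.norm_pairing_le[OF that c] by (simp add: mult.commute)
  note L = D2.label_on_carrier[of "\<lambda>f. ev f c", OF D1.dual_add(2) D1.dual_scale(2) bound]
  show "embed c \<in> carrier C''" unfolding embed_def by (rule L(1))
  show "ev' (embed c) f = ev f c" if "f \<in> carrier C'"
    unfolding embed_def by (rule L(2)) (use that in auto)
  show "vnorm C'' (embed c) \<le> vnorm C c"
    unfolding embed_def by (rule L(3)) (use norm_nonneg[OF c] in auto)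
qed

lemma embed_linear:
  assumes "c \<in> carrier C"
  shows "d \<in> carrier C \<Longrightarrow> embed (vadd C c d) = vadd C'' (embed c) (embed d)"
    and "embed (vscale C a c) = vscale C'' a (embed c)"
  by (rule D2.dual_eqI;
      use assms in \<open>simp add: embed_closed embed_apply D2.dual_add D2.dual_scale add_closed
        scale_closed D1.pairing_linear\<close>)+

lemma arens_left_embed_apply:
  assumes "a \<in> carrier C" "f \<in> carrier C'" "c \<in> carrier C"
  shows "ev (arens_left e e' C (embed a) f) c = ev f (amult C c a)"
  using assms by (simp add: arens_left_apply embed_apply embed_closed arens_right_apply
      arens_right_closed)

text \<open>The Arens product extends the product of \<open>C\<close>, so an inner derivation of the
  bidual can be restricted to \<open>C\<close>.\<close>

lemma arens_embed:
  assumes "a \<in> carrier C" "c \<in> carrier C"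
  shows "arens e e' C (embed a) (embed c) = embed (amult C a c)"
  by (rule D2.dual_eqI) (use assms in \<open>simp_all add: arens_closed embed_closed arens_apply
      embed_apply arens_left_closed arens_left_embed_apply mult_closed\<close>)

end


section \<open>The second adjoint of a derivation\<close>

lemma topspace_sigma_top: "topspace (sigma_top X F) \<subseteq> carrier X"
  by (auto simp: sigma_top_def)

text \<open>The form \<open>x \<mapsto> \<langle>G, z x\<rangle>\<close> is the composition of a
  weak*-to-weak continuous map with a weakly continuous one.\<close>

lemma (in arens_bidual) continuous_multiplication_evaluation:
  assumes z: "z \<in> carrier C''" and G: "G \<in> functionals C''"
    and cont: "continuous_map (weak_star_top e' C') (weak_top (arens_algebra e e' C)) (arens e e' C z)"
  shows "\<exists>g\<in>carrier C'. \<forall>x\<in>carrier C''. G (arens e e' C z x) = ev' x g"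
proof (rule D2.weak_star_continuous_evaluation)
  let ?W = "{w \<in> carrier C''. G w \<in> ball 0 1}"
  have "openin (weak_top (arens_algebra e e' C)) ?W"
    unfolding weak_top_def sigma_top_def arens_algebra_simps
    by (rule topology_generated_by_Basis) (use G open_ball in blast)
  then have "openin (weak_star_top e' C')
      {p \<in> topspace (weak_star_top e' C'). arens e e' C z p \<in> ?W}"
    by (rule openin_continuous_map_preimage[OF cont])
  also have "{p \<in> topspace (weak_star_top e' C'). arens e e' C z p \<in> ?W}
      = {p \<in> topspace (weak_star_top e' C'). G (arens e e' C z p) \<in> ball 0 1}"
    using topspace_sigma_top[of C''] z unfolding weak_star_top_def by (auto intro: arens_closed)
  finally show "openin (weak_star_top e' C')
      {p \<in> topspace (weak_star_top e' C'). G (arens e e' C z p) \<in> ball 0 1}" .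
qed (simp_all add: z arens_linear arens_closed functionals_linear[OF G])

locale derivation_bidual = arens_bidual C e e'
  for C :: "('u, 'k::real_normed_field, 'z) nalg_scheme" and e e' :: "('u \<Rightarrow> 'k) \<Rightarrow> 'u" +
  fixes D :: "'u \<Rightarrow> 'u \<Rightarrow> 'k"
  assumes derivation: "bounded_derivation C D"
begin

lemma D_functional: "c \<in> carrier C \<Longrightarrow> D c \<in> functionals C"
  using derivation by (simp add: bounded_derivation_def)

lemma label_D_closed: "c \<in> carrier C \<Longrightarrow> e (D c) \<in> carrier C'"
  by (simp add: D_functional D1.label_closed)

lemma ev_label_D: "c \<in> carrier C \<Longrightarrow> ev (e (D c)) = D c"
  by (simp add: D_functional D1.pairing_label)

lemma label_D_linear:
  assumes "c \<in> carrier C"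
  shows "d \<in> carrier C \<Longrightarrow> e (D (vadd C c d)) = vadd C' (e (D c)) (e (D d))"
    and "e (D (vscale C a c)) = vscale C' a (e (D c))"
  using derivation assms by (simp_all add: bounded_derivation_def dual_def ev_label_D)

lemma D_mult: "c \<in> carrier C \<Longrightarrow> d \<in> carrier C \<Longrightarrow> b \<in> carrier C \<Longrightarrow>
    D (amult C c d) b = D d (amult C b c) + D c (amult C d b)"
  using derivation
  by (simp add: bounded_derivation_def left_act_def right_act_def on_carrier_def)

definition derivation_bound :: real where
  "derivation_bound = (SOME K. 0 \<le> K \<and> (\<forall>c\<in>carrier C. vnorm C' (e (D c)) \<le> K * vnorm C c))"

lemma derivation_bound_nonneg: "0 \<le> derivation_bound"
  and derivation_bound: "c \<in> carrier C \<Longrightarrow> vnorm C' (e (D c)) \<le> derivation_bound * vnorm C c"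
proof -
  obtain K where K: "\<forall>c\<in>carrier C. fnorm C (D c) \<le> K * vnorm C c"
    using derivation unfolding bounded_derivation_def by blast
  have "vnorm C' (e (D c)) \<le> \<bar>K\<bar> * vnorm C c" if c: "c \<in> carrier C" for c
  proof -
    have "vnorm C' (e (D c)) \<le> K * vnorm C c"
      using K c by (simp add: D1.dual_norm ev_label_D)
    also have "\<dots> \<le> \<bar>K\<bar> * vnorm C c" using norm_nonneg[OF c] by (intro mult_right_mono) auto
    finally show ?thesis .
  qed
  then have "\<exists>K. 0 \<le> K \<and> (\<forall>c\<in>carrier C. vnorm C' (e (D c)) \<le> K * vnorm C c)"
    by (intro exI[of _ "\<bar>K\<bar>"]) simp
  from someI_ex[OF this] show "0 \<le> derivation_bound"
    and "c \<in> carrier C \<Longrightarrow> vnorm C' (e (D c)) \<le> derivation_bound * vnorm C c"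
    unfolding derivation_bound_def by blast+
qed

text \<open>The adjoint \<open>C'' \<rightarrow> C'\<close> of \<open>D\<close>; the second adjoint below is the adjoint of this map.\<close>

definition adjoint :: "'u \<Rightarrow> 'u" where
  "adjoint z = e (on_carrier C (\<lambda>c. ev' z (e (D c))))"

lemma adjoint_closed: "z \<in> carrier C'' \<Longrightarrow> adjoint z \<in> carrier C'"
  and adjoint_apply: "z \<in> carrier C'' \<Longrightarrow> c \<in> carrier C \<Longrightarrow> ev (adjoint z) c = ev' z (e (D c))"
  and adjoint_norm: "z \<in> carrier C'' \<Longrightarrow> vnorm C' (adjoint z) \<le> derivation_bound * vnorm C'' z"
proof -
  assume z: "z \<in> carrier C''"
  have B: "norm (ev' z (e (D c))) \<le> (derivation_bound * vnorm C'' z) * vnorm C c" if c: "c \<in> carrier C" for c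
  proof -
    have "norm (ev' z (e (D c))) \<le> vnorm C'' z * vnorm C' (e (D c))"
      using z c by (intro D2.norm_pairing_le label_D_closed)
    also have "\<dots> \<le> vnorm C'' z * (derivation_bound * vnorm C c)"
      using z c by (intro mult_left_mono derivation_bound D2.dual_norm_nonneg)
    finally show ?thesis by (simp add: ac_simps)
  qed
  note L = D1.label_on_carrier[of "\<lambda>c. ev' z (e (D c))", OF _ _ B]
  note lin = label_D_linear label_D_closed D2.pairing_linear
  show "adjoint z \<in> carrier C'"
    unfolding adjoint_def by (rule L(1)) (simp_all add: z lin)
  show "ev (adjoint z) c = ev' z (e (D c))" if "c \<in> carrier C"
    unfolding adjoint_def by (rule L(2)) (simp_all add: that z lin)
  show "vnorm C' (adjoint z) \<le> derivation_bound * vnorm C'' z"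
    unfolding adjoint_def by (rule L(3)) (simp_all add: z lin derivation_bound_nonneg D2.dual_norm_nonneg)
qed

lemma adjoint_linear:
  assumes "z \<in> carrier C''"
  shows "w \<in> carrier C'' \<Longrightarrow> adjoint (vadd C'' z w) = vadd C' (adjoint z) (adjoint w)"
    and "adjoint (vscale C'' a z) = vscale C' a (adjoint z)"
  by (rule D1.dual_eqI;
      use assms in \<open>simp add: adjoint_closed adjoint_apply D1.dual_add D1.dual_scale
        D2.dual_add D2.dual_scale label_D_closed\<close>)+

definition second_adjoint :: "'u \<Rightarrow> 'u \<Rightarrow> 'k" where
  "second_adjoint x = on_carrier C'' (\<lambda>z. ev' x (adjoint z))"

lemma second_adjoint_apply: "z \<in> carrier C'' \<Longrightarrow> second_adjoint x z = ev' x (adjoint z)"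
  by (simp add: second_adjoint_def on_carrier_def)

lemma norm_second_adjoint_le:
  assumes x: "x \<in> carrier C''" and z: "z \<in> carrier C''"
  shows "norm (second_adjoint x z) \<le> (derivation_bound * vnorm C'' x) * vnorm C'' z"
proof -
  have "norm (ev' x (adjoint z)) \<le> vnorm C'' x * vnorm C' (adjoint z)"
    using x z by (intro D2.norm_pairing_le adjoint_closed)
  also have "\<dots> \<le> vnorm C'' x * (derivation_bound * vnorm C'' z)"
    using x z by (intro mult_left_mono adjoint_norm D2.dual_norm_nonneg)
  finally show ?thesis using z by (simp add: ac_simps second_adjoint_apply)
qed

lemma second_adjoint_functional:
  assumes x: "x \<in> carrier C''"
  shows "second_adjoint x \<in> functionals C''"
proof -
  interpret E: normed_space C'' by (rule D2.normed_space_dual)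
  have "on_carrier C'' (\<lambda>z. ev' x (adjoint z)) \<in> functionals C''"
  proof (rule E.functionalI)
    fix z assume "z \<in> carrier C''"
    then show "norm (ev' x (adjoint z)) \<le> (derivation_bound * vnorm C'' x) * vnorm C'' z"
      using norm_second_adjoint_le[OF x, of z] by (simp add: second_adjoint_apply)
  qed (simp_all add: x adjoint_linear adjoint_closed D2.pairing_linear)
  then show ?thesis by (simp add: second_adjoint_def)
qed

lemma fnorm_second_adjoint_le: "x \<in> carrier C'' \<Longrightarrow> fnorm C'' (second_adjoint x) \<le> derivation_bound * vnorm C'' x"
proof -
  assume x: "x \<in> carrier C''"
  interpret E: normed_space C'' by (rule D2.normed_space_dual)
  show ?thesis
    using norm_second_adjoint_le[OF x] x derivation_bound_nonneg D2.dual_norm_nonneg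
    by (intro E.fnorm_le) simp_all
qed

text \<open>This is the derivation rule \<open>D (a b) = a D b + D a b\<close>, tested against
  \<open>z\<close> and read as an identity between functionals of \<open>b\<close>. The summand with
  \<open>D b\<close> is again a value of the adjoint because \<open>z\<close> composed with
  the left action of \<open>a\<close> is the Arens product of \<open>z\<close> with the image of
  \<open>a\<close> in the bidual.\<close>

lemma arens_right_adjoint:
  assumes z: "z \<in> carrier C''" and a: "a \<in> carrier C"
  shows "arens_right e C (adjoint z) a
    = vadd C' (adjoint (arens e e' C z (embed a))) (arens_left e e' C z (e (D a)))"
proof (rule D1.dual_eqI)
  fix b assume b: "b \<in> carrier C"
  have "e (D (amult C a b))
      = vadd C' (arens_left e e' C (embed a) (e (D b))) (arens_right e C (e (D a)) b)"
    by (rule D1.dual_eqI)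
      (simp_all add: a b label_D_closed mult_closed D1.dual_add arens_left_closed embed_closed
        arens_right_closed ev_label_D D_mult arens_left_embed_apply arens_right_apply)
  then show "ev (arens_right e C (adjoint z) a) b
      = ev (vadd C' (adjoint (arens e e' C z (embed a))) (arens_left e e' C z (e (D a)))) b"
    using z a b
    by (simp add: arens_right_apply adjoint_closed adjoint_apply mult_closed D1.dual_add
        arens_closed embed_closed arens_left_closed arens_right_closed label_D_closed arens_apply
        arens_left_apply D2.pairing_linear)
qed (use z a in \<open>simp_all add: arens_right_closed adjoint_closed D1.dual_add arens_closed
        embed_closed arens_left_closed label_D_closed\<close>)

text \<open>The only place where the continuity of multiplication enters: it supplies the
  element \<open>g\<close> of the dual that represents \<open>x \<mapsto> \<langle>D'' y, z x\<rangle>\<close>.\<close>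

lemma second_adjoint_arens:
  assumes xyz: "x \<in> carrier C''" "y \<in> carrier C''" "z \<in> carrier C''"
    and cont: "continuous_map (weak_star_top e' C') (weak_top (arens_algebra e e' C)) (arens e e' C z)"
  shows "second_adjoint (arens e e' C x y) z
    = second_adjoint y (arens e e' C z x) + second_adjoint x (arens e e' C y z)"
proof -
  obtain g where g: "g \<in> carrier C'"
    "\<And>w. w \<in> carrier C'' \<Longrightarrow> second_adjoint y (arens e e' C z w) = ev' w g"
    using continuous_multiplication_evaluation[OF xyz(3) second_adjoint_functional[OF xyz(2)] cont] by blast
  have "arens_left e e' C y (adjoint z) = vadd C' g (adjoint (arens e e' C y z))"
  proof (rule D1.dual_eqI)
    fix a assume a: "a \<in> carrier C"
    have "ev g a = ev' y (adjoint (arens e e' C z (embed a)))"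
      using g(2)[OF embed_closed[OF a]] xyz a g(1)
      by (simp add: second_adjoint_apply arens_closed embed_closed embed_apply)
    then show "ev (arens_left e e' C y (adjoint z)) a
        = ev (vadd C' g (adjoint (arens e e' C y z))) a"
      using xyz a g(1)
      by (simp add: arens_left_apply adjoint_closed arens_right_adjoint D2.pairing_linear
          arens_closed embed_closed arens_left_closed label_D_closed D1.dual_add adjoint_apply
          arens_apply)
  qed (use xyz g(1) in \<open>simp_all add: arens_left_closed adjoint_closed D1.dual_add arens_closed\<close>)
  then show ?thesis
    using xyz g by (simp add: second_adjoint_apply arens_closed arens_apply adjoint_closed
        D2.pairing_linear)
qed

lemma bounded_derivation_second_adjoint:
  assumes cont: "\<And>z. z \<in> carrier C'' \<Longrightarrow>
    continuous_map (weak_star_top e' C') (weak_top (arens_algebra e e' C)) (arens e e' C z)"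
  shows "bounded_derivation (arens_algebra e e' C) second_adjoint"
  unfolding bounded_derivation_def arens_algebra_simps
proof (intro conjI ballI allI)
  fix x y assume x: "x \<in> carrier C''" and y: "y \<in> carrier C''"
  show "second_adjoint (vadd C'' x y) = (\<lambda>z. second_adjoint x z + second_adjoint y z)"
    using x y by (auto simp: second_adjoint_def on_carrier_def D2.dual_add)
  show "second_adjoint (arens e e' C x y) = (\<lambda>z. left_act (arens_algebra e e' C) x (second_adjoint y) z
      + right_act (arens_algebra e e' C) (second_adjoint x) y z)"
  proof
    fix z show "second_adjoint (arens e e' C x y) z
      = left_act (arens_algebra e e' C) x (second_adjoint y) z
        + right_act (arens_algebra e e' C) (second_adjoint x) y z"
    proof (cases "z \<in> carrier C''")
      case True
      then show ?thesis
        using second_adjoint_arens[OF x y True cont[OF True]]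
        by (simp add: left_act_def right_act_def on_carrier_def)
    qed (simp add: left_act_def right_act_def on_carrier_def second_adjoint_def)
  qed
next
  fix a x assume "x \<in> carrier C''"
  then show "second_adjoint (vscale C'' a x) = (\<lambda>z. a * second_adjoint x z)"
    by (auto simp: second_adjoint_def on_carrier_def D2.dual_scale)
next
  show "\<exists>K. \<forall>x\<in>carrier C''. fnorm C'' (second_adjoint x) \<le> K * vnorm C'' x"
    using fnorm_second_adjoint_le by blast
qed (rule second_adjoint_functional)

text \<open>On the image of \<open>C\<close> the second adjoint is \<open>D\<close> itself, so the functional
  that implements it can be pulled back to \<open>C\<close>.\<close>

lemma inner_if_second_adjoint_inner:
  assumes "inner_derivation (arens_algebra e e' C) second_adjoint"
  shows "inner_derivation C D"
proof -
  obtain F where F: "F \<in> functionals C''"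
    and inner: "\<forall>x\<in>carrier C''. second_adjoint x = (\<lambda>z. left_act (arens_algebra e e' C) x F z
      - right_act (arens_algebra e e' C) F x z)"
    using assms unfolding inner_derivation_def arens_algebra_simps by blast
  define f where "f = on_carrier C (\<lambda>c. F (embed c))"
  have f: "f \<in> functionals C"
    unfolding f_def
  proof (rule functionalI)
    interpret E: normed_space C'' by (rule D2.normed_space_dual)
    fix c assume c: "c \<in> carrier C"
    have "norm (F (embed c)) \<le> fnorm C'' F * vnorm C'' (embed c)"
      by (rule E.norm_le_fnorm[OF F embed_closed[OF c]])
    also have "\<dots> \<le> fnorm C'' F * vnorm C c"
      by (intro mult_left_mono embed_norm c E.fnorm_nonneg F)
    finally show "norm (F (embed c)) \<le> fnorm C'' F * vnorm C c" .
  qed (simp_all add: embed_linear embed_closed functionals_linear[OF F])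
  have "D c = (\<lambda>d. left_act C c f d - right_act C f c d)" if c: "c \<in> carrier C" for c
  proof
    fix d show "D c d = left_act C c f d - right_act C f c d"
    proof (cases "d \<in> carrier C")
      case True
      have "D c d = second_adjoint (embed c) (embed d)"
        using c True by (simp add: second_adjoint_apply embed_closed embed_apply adjoint_closed
            adjoint_apply label_D_closed ev_label_D)
      also have "\<dots> = F (arens e e' C (embed d) (embed c)) - F (arens e e' C (embed c) (embed d))"
        using c True inner
        by (simp add: embed_closed left_act_def right_act_def on_carrier_def)
      also have "\<dots> = left_act C c f d - right_act C f c d"
        using c True
        by (simp add: arens_embed f_def left_act_def right_act_def on_carrier_def mult_closed)
      finally show ?thesis .
    next
      case False
      then show ?thesis
        using functionals_off[OF D_functional[OF c]]
        by (simp add: left_act_def right_act_def on_carrier_def)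
    qed
  qed
  then show ?thesis using f unfolding inner_derivation_def by blast
qed

end

lemma (in arens_bidual) weakly_amenable_if_arens:
  assumes "\<And>z. z \<in> carrier C'' \<Longrightarrow>
      continuous_map (weak_star_top e' C') (weak_top (arens_algebra e e' C)) (arens e e' C z)"
    and "weakly_amenable (arens_algebra e e' C)"
  shows "weakly_amenable C"
  unfolding weakly_amenable_def
proof (intro allI impI)
  fix D assume "bounded_derivation C D"
  then interpret derivation_bidual C e e' D by unfold_locales
  show "inner_derivation C D"
    using assms bounded_derivation_second_adjoint inner_if_second_adjoint_inner
    unfolding weakly_amenable_def by blast
qed

section \<open>Iterated duals\<close>

lemma ndual_alg_Suc:
  "ndual_alg e A (2 * Suc m) = arens_algebra (e (2 * m)) (e (2 * m + 1)) (ndual_alg e A (2 * m))"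
  by (simp add: ndual_alg_def arens_algebra_def)

lemma functionals_ndual_alg: "functionals (ndual_alg e A n) = functionals (ndual e A n)"
  and dual_ndual_alg: "dual e' (ndual_alg e A n) = dual e' (ndual e A n)"
  by (simp_all add: ndual_alg_def)

lemma arens_bidual_ndual_alg:
  assumes A: "nonassoc_normed_algebra (ndual_alg e A (2 * m))" and l: "labelling e A (2 * m + 2)"
  shows "arens_bidual (ndual_alg e A (2 * m)) (e (2 * m)) (e (2 * m + 1))"
proof (intro arens_bidual.intro A arens_bidual_axioms.intro)
  show "inj_on (e (2 * m)) (functionals (ndual_alg e A (2 * m)))"
    using l by (simp add: labelling_def functionals_ndual_alg)
  have "inj_on (e (2 * m + 1)) (functionals (ndual e A (2 * m + 1)))"
    using l unfolding labelling_def by (metis add_2_eq_Suc' lessI Suc_eq_plus1)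
  then show "inj_on (e (2 * m + 1)) (functionals (dual (e (2 * m)) (ndual_alg e A (2 * m))))"
    by (simp add: dual_ndual_alg)
qed

lemma nonassoc_normed_algebra_ndual_alg:
  assumes "banach_algebra A" "labelling e A (2 * m)"
  shows "nonassoc_normed_algebra (ndual_alg e A (2 * m))"
  using assms(2)
proof (induction m)
  case 0
  interpret banach_algebra A by (rule assms(1))
  show ?case
    unfolding ndual_alg_def
    by unfold_locales
      (simp_all add: nspace.extend_def nalg.fields_def nspace.truncate_def zero_closed add_closed
        scale_closed add_zero add_neg scale_add add_scale scale_scale scale_one
        norm_eq_zero norm_triangle norm_scale mult_closed add_mult mult_add scale_mult mult_scale
        norm_mult, (rule add_assoc add_commute; assumption)+)
next
  case (Suc m)
  have "labelling e A (2 * m)" "labelling e A (2 * m + 2)"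
    using Suc.prems by (simp_all add: labelling_def)
  then interpret arens_bidual "ndual_alg e A (2 * m)" "e (2 * m)" "e (2 * m + 1)"
    using Suc.IH by (intro arens_bidual_ndual_alg) simp_all
  show ?case unfolding ndual_alg_Suc by (rule nonassoc_normed_algebra_arens)
qed

theorem mainTheorem6:
  fixes A :: "('u, 'k::real_normed_field) nalg"
    and e :: "nat \<Rightarrow> ('u \<Rightarrow> 'k) \<Rightarrow> 'u"
    and n :: nat
  assumes "banach_algebra A"
    and "even n" and "n \<ge> 2"
    and "labelling e A n"
    and "Z1_tilde e A n = carrier (ndual_alg e A n)"
    and "weakly_amenable (ndual_alg e A n)"
  shows "weakly_amenable (ndual_alg e A (n - 2))"
proof -
  obtain m where n: "n = 2 * Suc m"
    using assms(2,3) by (metis evenE gr0_implies_Suc mult_0_right not_gr_zero not_numeral_le_zero)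
  have l: "labelling e A (2 * m)" "labelling e A (2 * m + 2)"
    using assms(4) by (simp_all add: n labelling_def)
  interpret arens_bidual "ndual_alg e A (2 * m)" "e (2 * m)" "e (2 * m + 1)"
    by (intro arens_bidual_ndual_alg nonassoc_normed_algebra_ndual_alg assms(1) l)
  have "weakly_amenable (ndual_alg e A (2 * m))"
  proof (rule weakly_amenable_if_arens)
    fix z assume z: "z \<in> carrier C''"
    have "n - 1 = 2 * m + 1" by (simp add: n)
    moreover have "ndual e A (2 * m + 1) = C'" by (simp add: dual_ndual_alg)
    moreover have "z \<in> Z1_tilde e A n" using z assms(5) unfolding n ndual_alg_Suc by simp
    ultimately show "continuous_map (weak_star_top (e (2 * m + 1)) C')
        (weak_top (arens_algebra (e (2 * m)) (e (2 * m + 1)) (ndual_alg e A (2 * m))))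
        (arens (e (2 * m)) (e (2 * m + 1)) (ndual_alg e A (2 * m)) z)"
      by (simp add: Z1_tilde_def n ndual_alg_Suc del: mult_Suc_right ndual.simps)
  next
    show "weakly_amenable (arens_algebra (e (2 * m)) (e (2 * m + 1)) (ndual_alg e A (2 * m)))"
      using assms(6) unfolding n ndual_alg_Suc .
  qed
  then show ?thesis by (simp add: n)
qed

end
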